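(* Let $\Gamma=(V,E)$ be a point-transitive, reflexive, locally finite relation and let $v\in V$. Let $F\subset V$ satisfy $F\cap\Gamma^-(v)=\{v\}$. (i) If $F$ is finite, then $|\Gamma(F)\setminus F|\ge|\Gamma(v)|-1$. (ii) If $F$ is cofinite (i.e. $V\setminus F$ is finite), then $|\Gamma(F)\setminus F|\ge|\Gamma^-(v)|-1$.
   Context: A relation is a pair $\Gamma=(V,E)$ with $E\subset V\times V$; for $X\subset V$, $\Gamma(X)=\{y: (x,y)\in E \text{ for some } x\in X\}$, $\Gamma^-(X)=\{y:(y,x)\in E\text{ for some }x\in X\}$, $\Gamma(x)=\Gamma(\{x\})$. $\Gamma$ is reflexive if $(x,x)\in E$ for all $x$, and locally finite if $\Gamma(x)$ and $\Gamma^-(x)$ are finite for all $x$. An automorphism is a bijection $f:V\to V$ with $\Gamma(f(x))=f(\Gamma(x))$ for all $x$; $\Gamma$ is point-transitive if for all $x,y\in V$ there is an automorphism $f$ with $f(x)=y$. *)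

theory Defs
  imports Main
begin

definition is_relation :: "'a set \<Rightarrow> ('a \<times> 'a) set \<Rightarrow> bool" where
  "is_relation V E \<longleftrightarrow> E \<subseteq> V \<times> V"

definition out_nbhd :: "('a \<times> 'a) set \<Rightarrow> 'a set \<Rightarrow> 'a set" where
  "out_nbhd E X = {y. \<exists>x\<in>X. (x, y) \<in> E}"

definition in_nbhd :: "('a \<times> 'a) set \<Rightarrow> 'a set \<Rightarrow> 'a set" where
  "in_nbhd E X = {y. \<exists>x\<in>X. (y, x) \<in> E}"

definition rel_reflexive :: "'a set \<Rightarrow> ('a \<times> 'a) set \<Rightarrow> bool" where
  "rel_reflexive V E \<longleftrightarrow> (\<forall>x\<in>V. (x, x) \<in> E)"

definition locally_finite :: "'a set \<Rightarrow> ('a \<times> 'a) set \<Rightarrow> bool" where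
  "locally_finite V E \<longleftrightarrow>
     (\<forall>x\<in>V. finite (out_nbhd E {x}) \<and> finite (in_nbhd E {x}))"

definition rel_automorphism :: "'a set \<Rightarrow> ('a \<times> 'a) set \<Rightarrow> ('a \<Rightarrow> 'a) \<Rightarrow> bool" where
  "rel_automorphism V E f \<longleftrightarrow>
     bij_betw f V V \<and> (\<forall>x\<in>V. out_nbhd E {f x} = f ` out_nbhd E {x})"

definition point_transitive :: "'a set \<Rightarrow> ('a \<times> 'a) set \<Rightarrow> bool" where
  "point_transitive V E \<longleftrightarrow>
     (\<forall>x\<in>V. \<forall>y\<in>V. \<exists>f. rel_automorphism V E f \<and> f x = y)"

end

theory Submission
  imports Defs
begin

text \<open>Call a finite counterexample to (i) deficient. Let F be one of least size, at the point
  v, and let X be a nonempty finite set of least boundary. Take an automorphism g with g v in X.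
  Then gF \<inter> X still meets the in-neighbourhood of g v only in g v. If gF were not inside X,
  this intersection would be smaller than F, hence not deficient, so its boundary would exceed that
  of F; \<open>boundary_submodular\<close> would then give gF \<union> X a smaller boundary than X.
  So gF \<subseteq> X for all such g, which puts F inside \<open>block v\<close>, a finite set on
  which the relation is again point-transitive (\<open>restrict_block\<close>). If the finite case
  is known there, F satisfies the bound inside the block, and \<open>boundary_ge_of_restrict\<close>
  carries it back to V: a contradiction (\<open>no_minimal_deficient\<close>).

  For finite V the proof is by induction on |V|. Since V has empty boundary, X is chosen among sets
  with \<Gamma>(X) \<noteq> V, and the argument needs X and F to be small enough. The passage from X
  to V minus \<Gamma>(X) exchanges the relation with its converse, in- and out-degrees agree, and a
  count shows that the argument works for one of the two (\<open>not_deficient_finite\<close>).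

  Part (ii) is (i) for the converse, applied to the set of \<open>dual_set\<close>.\<close>

definition boundary :: "('a \<times> 'a) set \<Rightarrow> 'a set \<Rightarrow> 'a set" where
  "boundary E X = out_nbhd E X - X"

text \<open>The point \<open>v\<close> is bound existentially because a translate of a deficient set
  is deficient at the translated point. \<open>V\<close> and \<open>E\<close> are arguments so that
  the notion also applies to converses and to blocks.\<close>

definition deficient :: "'a set \<Rightarrow> ('a \<times> 'a) set \<Rightarrow> 'a set \<Rightarrow> bool" where
  "deficient V E F \<longleftrightarrow> F \<subseteq> V \<and> finite F \<and>
     (\<exists>v. F \<inter> in_nbhd E {v} = {v} \<and> card (boundary E F) < card (out_nbhd E {v}) - 1)"

locale transitive_relation =
  fixes V :: "'a set" and E :: "('a \<times> 'a) set"
  assumes relation: "is_relation V E"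
    and transitive: "point_transitive V E"
    and reflexive: "rel_reflexive V E"
    and loc_finite: "locally_finite V E"

section \<open>Converses and automorphisms\<close>

lemma out_nbhd_converse: "out_nbhd (E\<inverse>) = in_nbhd E"
  by (auto simp: fun_eq_iff out_nbhd_def in_nbhd_def)

lemma in_nbhd_converse: "in_nbhd (E\<inverse>) = out_nbhd E"
  by (auto simp: fun_eq_iff out_nbhd_def in_nbhd_def)

text \<open>Surjectivity of \<open>f\<close> on \<open>V\<close> ensures that no out-neighbour of
  \<open>f x\<close> is missed. This form is symmetric in the two endpoints, so it passes at once to
  the converse and to restrictions.\<close>

lemma rel_automorphism_iff:
  assumes "E \<subseteq> V \<times> V"
  shows "rel_automorphism V E f \<longleftrightarrow>
    bij_betw f V V \<and> (\<forall>x\<in>V. \<forall>y\<in>V. (f x, f y) \<in> E \<longleftrightarrow> (x, y) \<in> E)"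
proof
  assume "rel_automorphism V E f"
  then have bij: "bij_betw f V V" and out: "\<And>x. x \<in> V \<Longrightarrow> out_nbhd E {f x} = f ` out_nbhd E {x}"
    by (auto simp: rel_automorphism_def)
  have "(f x, f y) \<in> E \<longleftrightarrow> (x, y) \<in> E" if "x \<in> V" "y \<in> V" for x y
  proof -
    have "(f x, f y) \<in> E \<longleftrightarrow> f y \<in> f ` out_nbhd E {x}"
      using out[OF \<open>x \<in> V\<close>] by (auto simp: out_nbhd_def)
    also have "\<dots> \<longleftrightarrow> y \<in> out_nbhd E {x}"
      using bij \<open>y \<in> V\<close> assms
      by (intro inj_on_image_mem_iff[where B = V]) (auto simp: bij_betw_def out_nbhd_def)
    finally show ?thesis by (simp add: out_nbhd_def)
  qed
  with bij show "bij_betw f V V \<and> (\<forall>x\<in>V. \<forall>y\<in>V. (f x, f y) \<in> E \<longleftrightarrow> (x, y) \<in> E)"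
    by blast
next
  assume f: "bij_betw f V V \<and> (\<forall>x\<in>V. \<forall>y\<in>V. (f x, f y) \<in> E \<longleftrightarrow> (x, y) \<in> E)"
  have "y \<in> f ` out_nbhd E {x}" if "x \<in> V" "(f x, y) \<in> E" for x y
  proof -
    have "y \<in> f ` V" using that assms f by (auto simp: bij_betw_def)
    then show ?thesis using that f by (auto simp: out_nbhd_def)
  qed
  moreover have "(f x, f y) \<in> E" if "x \<in> V" "(x, y) \<in> E" for x y
    using that f assms by blast
  ultimately show "rel_automorphism V E f"
    using f unfolding rel_automorphism_def by (auto simp: out_nbhd_def)
qed

section \<open>Boundaries and submodularity\<close>

context transitive_relation
begin

lemma edges_subset: "E \<subseteq> V \<times> V"
  using relation by (simp add: is_relation_def)

lemma out_nbhd_subset: "out_nbhd E X \<subseteq> V"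
  using edges_subset by (auto simp: out_nbhd_def)

lemma subset_out_nbhd: "X \<subseteq> V \<Longrightarrow> X \<subseteq> out_nbhd E X"
  using reflexive by (auto simp: out_nbhd_def rel_reflexive_def)

lemma finite_out_nbhd:
  assumes "finite X" "X \<subseteq> V"
  shows "finite (out_nbhd E X)"
proof -
  have "out_nbhd E X = (\<Union>x\<in>X. out_nbhd E {x})" by (auto simp: out_nbhd_def)
  then show ?thesis using assms loc_finite by (auto simp: locally_finite_def)
qed

lemma finite_boundary: "finite X \<Longrightarrow> X \<subseteq> V \<Longrightarrow> finite (boundary E X)"
  by (simp add: boundary_def finite_out_nbhd)

lemma card_out_nbhd:
  assumes "finite X" "X \<subseteq> V"
  shows "card (out_nbhd E X) = card X + card (boundary E X)"
  using assms subset_out_nbhd[of X] finite_out_nbhd[of X]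
  by (simp add: boundary_def card_Diff_subset card_mono)

text \<open>By reflexivity the boundary of X has |\<Gamma>(X)| - |X| elements. Cardinality is
  modular, and \<Gamma> preserves unions while \<Gamma>(A \<inter> B) \<subseteq> \<Gamma>(A)
  \<inter> \<Gamma>(B).\<close>

lemma boundary_submodular:
  assumes "finite A" "A \<subseteq> V" "finite B" "B \<subseteq> V"
  shows "card (boundary E (A \<union> B)) + card (boundary E (A \<inter> B))
    \<le> card (boundary E A) + card (boundary E B)"
proof -
  have un: "out_nbhd E (A \<union> B) = out_nbhd E A \<union> out_nbhd E B"
    by (auto simp: out_nbhd_def)
  have "out_nbhd E (A \<inter> B) \<subseteq> out_nbhd E A \<inter> out_nbhd E B"
    by (auto simp: out_nbhd_def)
  then have "card (out_nbhd E (A \<inter> B)) \<le> card (out_nbhd E A \<inter> out_nbhd E B)"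
    using assms by (intro card_mono) (auto simp: finite_out_nbhd)
  moreover have "card (out_nbhd E A) + card (out_nbhd E B)
      = card (out_nbhd E (A \<union> B)) + card (out_nbhd E A \<inter> out_nbhd E B)"
    unfolding un using assms by (intro card_Un_Int finite_out_nbhd)
  moreover have "card A + card B = card (A \<union> B) + card (A \<inter> B)"
    using assms by (intro card_Un_Int)
  ultimately show ?thesis
    using assms card_out_nbhd[of A] card_out_nbhd[of B] card_out_nbhd[of "A \<union> B"]
      card_out_nbhd[of "A \<inter> B"]
    by (simp add: le_infI1)
qed

section \<open>Translates under automorphisms\<close>

abbreviation "aut \<equiv> rel_automorphism V E"

lemmas aut_iff = rel_automorphism_iff[OF edges_subset]

lemma aut_mem: "aut f \<Longrightarrow> x \<in> V \<Longrightarrow> f x \<in> V"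
  by (auto simp: rel_automorphism_def bij_betw_def)

lemma aut_inj: "aut f \<Longrightarrow> inj_on f V"
  by (auto simp: rel_automorphism_def bij_betw_def)

lemma aut_comp:
  assumes "aut f" "aut g"
  shows "aut (\<lambda>x. g (f x))"
  using assms bij_betw_trans[of f V V g V] aut_mem[OF assms(1)]
  by (simp add: aut_iff comp_def)

lemma obtain_aut:
  assumes "x \<in> V" "y \<in> V"
  obtains f where "aut f" "f x = y"
  using assms transitive by (auto simp: point_transitive_def)

lemma aut_out_nbhd:
  assumes "aut f" "X \<subseteq> V"
  shows "out_nbhd E (f ` X) = f ` out_nbhd E X"
proof -
  have "out_nbhd E Y = (\<Union>y\<in>Y. out_nbhd E {y})" for Y by (auto simp: out_nbhd_def)
  note this[of X] this[of "f ` X"]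
  moreover have "out_nbhd E {f x} = f ` out_nbhd E {x}" if "x \<in> X" for x
    using that assms by (auto simp: rel_automorphism_def)
  ultimately show ?thesis by auto
qed

lemma card_boundary_aut:
  assumes "aut f" "X \<subseteq> V"
  shows "card (boundary E (f ` X)) = card (boundary E X)"
proof -
  have "boundary E (f ` X) = f ` boundary E X"
    using assms out_nbhd_subset[of X]
    by (simp add: boundary_def aut_out_nbhd)
      (subst inj_on_image_set_diff[OF aut_inj[OF assms(1)]], auto)
  moreover have "inj_on f (boundary E X)"
    using aut_inj[OF assms(1)] out_nbhd_subset[of X]
    by (auto simp: boundary_def intro: inj_on_subset)
  ultimately show ?thesis by (simp add: card_image)
qed

lemma card_out_nbhd_const:
  assumes "x \<in> V" "y \<in> V"
  shows "card (out_nbhd E {x}) = card (out_nbhd E {y})"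
proof -
  obtain f where f: "aut f" "f x = y" using assms by (rule obtain_aut)
  then have "out_nbhd E {y} = f ` out_nbhd E {x}"
    using aut_out_nbhd[of f "{x}"] assms by simp
  moreover have "inj_on f (out_nbhd E {x})"
    using aut_inj[OF f(1)] out_nbhd_subset by (rule inj_on_subset)
  ultimately show ?thesis by (simp add: card_image)
qed

section \<open>Duality with the converse relation\<close>

lemma converse_transitive: "transitive_relation V (E\<inverse>)"
proof
  show "is_relation V (E\<inverse>)" using relation by (auto simp: is_relation_def)
  show "rel_reflexive V (E\<inverse>)" using reflexive by (auto simp: rel_reflexive_def)
  show "locally_finite V (E\<inverse>)"
    using loc_finite by (auto simp: locally_finite_def out_nbhd_converse in_nbhd_converse)
  have "E\<inverse> \<subseteq> V \<times> V" using edges_subset by auto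
  then have "rel_automorphism V (E\<inverse>) f" if "aut f" for f
    using that by (simp add: rel_automorphism_iff aut_iff)
  then show "point_transitive V (E\<inverse>)"
    using transitive unfolding point_transitive_def by blast
qed

text \<open>Double counting: the edges number |V| times the common out-degree, and also |V| times
  the common in-degree.\<close>

lemma card_in_nbhd_eq:
  assumes "finite V" "v \<in> V"
  shows "card (in_nbhd E {v}) = card (out_nbhd E {v})"
proof -
  have count: "card R = card V * card (out_nbhd R {v})" if R: "transitive_relation V R" for R
  proof -
    interpret R: transitive_relation V R by (fact R)
    have "R = (SIGMA x:V. out_nbhd R {x})"
      using R.edges_subset by (auto simp: out_nbhd_def)
    then have "card R = card (SIGMA x:V. out_nbhd R {x})" by (rule arg_cong)
    also have "\<dots> = (\<Sum>x\<in>V. card (out_nbhd R {x}))"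
      using assms R.finite_out_nbhd by (intro card_SigmaI) auto
    also have "\<dots> = (\<Sum>x\<in>V. card (out_nbhd R {v}))"
      using assms by (intro sum.cong refl R.card_out_nbhd_const)
    finally show ?thesis by simp
  qed
  have "card V * card (in_nbhd E {v}) = card V * card (out_nbhd E {v})"
    using count[OF converse_transitive] count[of E] transitive_relation_axioms
    by (auto simp: out_nbhd_converse)
  then show ?thesis using assms by auto
qed

lemma in_nbhd_complement_subset:
  "in_nbhd E (V - out_nbhd E X) \<subseteq> V - X"
  using edges_subset by (auto simp: in_nbhd_def out_nbhd_def)

lemma boundary_converse_complement:
  "boundary (E\<inverse>) (V - out_nbhd E X) \<subseteq> boundary E X"
  using in_nbhd_complement_subset[of X] edges_subset
  by (auto simp: boundary_def out_nbhd_converse)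

text \<open>Since \<open>v\<close> is in \<open>F\<close>, all of \<Gamma>(v) lies in \<Gamma>(F),
  so \<open>D\<close> meets it only in \<open>v\<close>. Adding \<open>v\<close> to the complement
  of \<Gamma>(F) contributes only in-neighbours of \<open>v\<close>, and these lie outside
  \<open>F\<close> except for \<open>v\<close> itself.\<close>

lemma dual_set:
  assumes "v \<in> V" "F \<subseteq> V" and F: "F \<inter> in_nbhd E {v} = {v}"
  defines "D \<equiv> insert v (V - out_nbhd E F)"
  shows "D \<inter> in_nbhd (E\<inverse>) {v} = {v}" "boundary (E\<inverse>) D \<subseteq> boundary E F"
proof -
  have v: "v \<in> F" "v \<in> out_nbhd E {v}"
    using F subset_out_nbhd[of "{v}"] assms by auto
  then show "D \<inter> in_nbhd (E\<inverse>) {v} = {v}"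
    by (auto simp: D_def in_nbhd_converse) (auto simp: out_nbhd_def)
  have "in_nbhd E D = in_nbhd E {v} \<union> in_nbhd E (V - out_nbhd E F)"
    by (auto simp: D_def in_nbhd_def)
  then have "in_nbhd E D \<subseteq> insert v (V - F)"
    using F in_nbhd_complement_subset[of F] edges_subset by (auto simp: in_nbhd_def)
  then show "boundary (E\<inverse>) D \<subseteq> boundary E F"
    by (auto simp: boundary_def D_def out_nbhd_converse)
qed

end

section \<open>Blocks cut out by a finite set\<close>

locale block_of = transitive_relation +
  fixes X :: "'a set"
  assumes X: "X \<subseteq> V" "X \<noteq> {}" "finite X"
begin

text \<open>This is the intersection of all translates of \<open>X\<close> that contain \<open>w\<close>; expressed through
  preimages, it needs no inverse automorphisms.\<close>

definition block :: "'a \<Rightarrow> 'a set" where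
  "block w = {u \<in> V. \<forall>g. aut g \<longrightarrow> g w \<in> X \<longrightarrow> g u \<in> X}"

lemma mem_block: "w \<in> V \<Longrightarrow> w \<in> block w"
  by (simp add: block_def)

lemma block_subset: "block w \<subseteq> V"
  by (auto simp: block_def)

lemma finite_card_block:
  assumes "w \<in> V"
  shows "finite (block w)" "card (block w) \<le> card X"
proof -
  obtain x where "x \<in> X" using X by auto
  then obtain g where g: "aut g" "g w = x" using X assms obtain_aut by blast
  have inj: "inj_on g (block w)"
    using aut_inj[OF g(1)] block_subset by (rule inj_on_subset)
  have "g ` block w \<subseteq> X" using g \<open>x \<in> X\<close> by (auto simp: block_def)
  then show "finite (block w)" "card (block w) \<le> card X"
    using inj X by (auto intro: inj_on_finite card_inj_on_le)
qed

lemma aut_block_subset: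
  assumes "aut h" "w \<in> V"
  shows "h ` block w \<subseteq> block (h w)"
  using assms aut_comp[OF assms(1)] by (auto simp: block_def aut_mem)

lemma card_block_le:
  assumes "u \<in> V" "w \<in> V"
  shows "card (block u) \<le> card (block w)"
proof -
  obtain h where h: "aut h" "h u = w" using assms by (rule obtain_aut)
  have "inj_on h (block u)"
    using aut_inj[OF h(1)] block_subset by (rule inj_on_subset)
  then show ?thesis
    using aut_block_subset[OF h(1) assms(1)] h finite_card_block assms
    by (intro card_inj_on_le) auto
qed

text \<open>The condition defining blocks is transitive, so \<open>block u\<close> is contained in
  \<open>block w\<close>; all blocks have the same finite size. Hence blocks partition
  \<open>V\<close>.\<close>

lemma block_eq:
  assumes "w \<in> V" "u \<in> block w"
  shows "block u = block w"
proof (rule card_subset_eq)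
  have "u \<in> V" using assms block_subset by auto
  then show "card (block u) = card (block w)"
    using assms card_block_le by (simp add: order_antisym)
  show "block u \<subseteq> block w" using assms by (auto simp: block_def)
qed (use assms finite_card_block in auto)

text \<open>An automorphism of \<open>V\<close> taking one point of a block to another maps the
  block injectively into itself, hence onto itself by finiteness.\<close>

lemma restrict_block:
  assumes "v \<in> V"
  defines "B \<equiv> block v"
  shows "transitive_relation B (E \<inter> B \<times> B)"
proof
  show "is_relation B (E \<inter> B \<times> B)" by (simp add: is_relation_def)
  show "rel_reflexive B (E \<inter> B \<times> B)"
    using reflexive block_subset by (auto simp: rel_reflexive_def B_def)
  have "finite B" using finite_card_block assms by simp
  then show "locally_finite B (E \<inter> B \<times> B)"
    by (auto simp: locally_finite_def out_nbhd_def in_nbhd_def intro: finite_subset[of _ B])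
  show "point_transitive B (E \<inter> B \<times> B)"
    unfolding point_transitive_def
  proof (intro ballI)
    fix x y assume xy: "x \<in> B" "y \<in> B"
    then have V: "x \<in> V" "y \<in> V" using block_subset by (auto simp: B_def)
    have B: "block x = B" "block y = B" using xy assms block_eq by (auto simp: B_def)
    obtain h where h: "aut h" "h x = y" using V by (rule obtain_aut)
    have inj: "inj_on h B"
      using aut_inj[OF h(1)] block_subset by (auto simp: B_def intro: inj_on_subset)
    have "h ` B \<subseteq> B" using aut_block_subset[OF h(1) V(1)] h B by simp
    then have "bij_betw h B B"
      using inj \<open>finite B\<close> by (simp add: bij_betw_def endo_inj_surj)
    then have "rel_automorphism B (E \<inter> B \<times> B) h"
      using h(1) block_subset[of v] unfolding aut_iff B_def
      by (subst rel_automorphism_iff) (auto simp: bij_betw_def subset_iff)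
    then show "\<exists>f. rel_automorphism B (E \<inter> B \<times> B) f \<and> f x = y" using h by auto
  qed
qed

end

section \<open>Minimal deficient sets\<close>

context transitive_relation
begin

text \<open>The out-neighbours of \<open>v\<close> outside \<open>B\<close> are exactly the degree
  lost by restricting, and they all lie in the boundary of \<open>F\<close> because \<open>F\<close>
  is inside \<open>B\<close>.\<close>

lemma boundary_ge_of_restrict:
  assumes "B \<subseteq> V" "F \<subseteq> B" "finite B" "v \<in> F"
    and IH: "card (boundary (E \<inter> B \<times> B) F) \<ge> card (out_nbhd (E \<inter> B \<times> B) {v}) - 1"
  shows "card (boundary E F) \<ge> card (out_nbhd E {v}) - 1"
proof -
  have vB: "v \<in> B" "v \<in> V" "F \<subseteq> V" "finite F" using assms finite_subset by auto
  have fin: "finite (out_nbhd E {v})" using vB by (intro finite_out_nbhd) auto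
  have restr: "out_nbhd (E \<inter> B \<times> B) {v} = out_nbhd E {v} \<inter> B"
    using vB by (auto simp: out_nbhd_def)
  have "v \<in> out_nbhd E {v} \<inter> B" using vB subset_out_nbhd[of "{v}"] by auto
  then have "card (out_nbhd E {v} \<inter> B) \<noteq> 0" using fin by auto
  moreover have "card (out_nbhd E {v}) = card (out_nbhd E {v} \<inter> B) + card (out_nbhd E {v} - B)"
    using fin by (subst card_Un_disjoint[symmetric]) (auto intro: arg_cong[where f = card])
  moreover have "card (boundary (E \<inter> B \<times> B) F) + card (out_nbhd E {v} - B) \<le> card (boundary E F)"
  proof -
    have sub: "boundary (E \<inter> B \<times> B) F \<union> (out_nbhd E {v} - B) \<subseteq> boundary E F"
      using assms by (auto simp: boundary_def out_nbhd_def)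
    have "boundary (E \<inter> B \<times> B) F \<inter> (out_nbhd E {v} - B) = {}"
      by (auto simp: boundary_def out_nbhd_def)
    then show ?thesis
      using sub finite_boundary[OF vB(4,3)] finite_subset
      by (subst card_Un_disjoint[symmetric]) (auto intro!: card_mono)
  qed
  ultimately show ?thesis using IH restr by simp
qed

text \<open>By minimality of \<open>F\<close> and submodularity, every translate of \<open>F\<close> whose source lies in \<open>X\<close>
  is contained in \<open>X\<close>, so \<open>F\<close> lies in a block of the automorphism group.\<close>

lemma no_minimal_deficient:
  assumes F: "deficient V E F"
    and min: "\<And>F'. deficient V E F' \<Longrightarrow> card F \<le> card F'"
    and X: "X \<subseteq> V" "X \<noteq> {}" "finite X"
    and un: "\<And>Q. Q \<subseteq> V \<Longrightarrow> finite Q \<Longrightarrow> X \<subseteq> Q \<Longrightarrow> card Q < card X + card F \<Longrightarrow>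
      card (boundary E X) \<le> card (boundary E Q)"
    and IH: "\<And>B R F. transitive_relation B R \<Longrightarrow> B \<subseteq> V \<Longrightarrow> card B \<le> card X \<Longrightarrow> finite B \<Longrightarrow>
      \<not> deficient B R F"
  shows False
proof -
  interpret block_of V E X by unfold_locales (use X in auto)
  obtain v where Fv: "F \<inter> in_nbhd E {v} = {v}"
    and small: "card (boundary E F) < card (out_nbhd E {v}) - 1"
    and FV: "F \<subseteq> V" "finite F"
    using F by (auto simp: deficient_def)
  have v: "v \<in> F" "v \<in> V" using Fv FV by auto
  have "g ` F \<subseteq> X" if g: "aut g" "g v \<in> X" for g
  proof (rule ccontr)
    assume nsub: "\<not> g ` F \<subseteq> X"
    let ?G = "g ` F"
    have G: "?G \<subseteq> V" "finite ?G" "card ?G = card F"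
      using FV g aut_mem inj_on_subset[OF aut_inj[OF g(1)] FV(1)] by (auto simp: card_image)
    have deg: "card (out_nbhd E {g v}) = card (out_nbhd E {v})"
      using v g aut_mem by (intro card_out_nbhd_const) auto
    have bd: "card (boundary E ?G) = card (boundary E F)"
      using g FV by (intro card_boundary_aut) auto
    have "x = v" if "x \<in> F" "(g x, g v) \<in> E" for x
    proof -
      have "(x, v) \<in> E" using that g v FV unfolding aut_iff by blast
      then show ?thesis using that Fv by (auto simp: in_nbhd_def)
    qed
    moreover have "(g v, g v) \<in> E" using g v aut_mem reflexive by (auto simp: rel_reflexive_def)
    ultimately have "(?G \<inter> X) \<inter> in_nbhd E {g v} = {g v}"
      using g v by (auto simp: in_nbhd_def)
    moreover have "card (?G \<inter> X) < card F"
      using nsub G by (metis Int_lower1 inf.absorb_iff1 psubsetI psubset_card_mono)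
    then have "\<not> deficient V E (?G \<inter> X)" using min by force
    ultimately have "card (boundary E (?G \<inter> X)) \<ge> card (out_nbhd E {v}) - 1"
      using G deg unfolding deficient_def by (metis finite_Int le_infI1 linorder_not_le)
    \<comment> \<open>\<open>g v\<close> lies in both sets, which makes the size bound for the union
      strict.\<close>
    moreover have "card (boundary E X) \<le> card (boundary E (?G \<union> X))"
    proof (rule un)
      have "g v \<in> ?G \<inter> X" using g v by auto
      then have "card (?G \<inter> X) > 0" using X by (subst card_gt_0_iff) blast
      then show "card (?G \<union> X) < card X + card F"
        using card_Un_Int[OF G(2) X(3)] G(3) by linarith
    qed (use G X in auto)
    ultimately show False
      using boundary_submodular[OF G(2,1) X(3,1)] bd small by linarith
  qed
  then have FB: "F \<subseteq> block v" using FV by (auto simp: block_def)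
  let ?R = "E \<inter> block v \<times> block v"
  have fin: "finite (block v)" using finite_card_block v by simp
  have "F \<inter> in_nbhd ?R {v} = {v}"
    using Fv FB v mem_block[OF v(2)] by (auto simp: in_nbhd_def)
  moreover have "\<not> deficient (block v) ?R F"
    using IH restrict_block finite_card_block block_subset v by simp
  ultimately have "card (boundary ?R F) \<ge> card (out_nbhd ?R {v}) - 1"
    using FB FV unfolding deficient_def by (metis linorder_not_le)
  then have "card (boundary E F) \<ge> card (out_nbhd E {v}) - 1"
    using boundary_ge_of_restrict[OF block_subset FB fin v(1)] by simp
  then show False using small by simp
qed

section \<open>Finite relations\<close>

lemma deficient_finite:
  assumes "finite V" "deficient V E F"
  obtains D where "deficient V (E\<inverse>) D" "card D + card F + card (boundary E F) \<le> card V + 1"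
    and "out_nbhd E F \<noteq> V"
proof -
  obtain v where Fv: "F \<inter> in_nbhd E {v} = {v}"
    and small: "card (boundary E F) < card (out_nbhd E {v}) - 1"
    and FV: "F \<subseteq> V" "finite F"
    using assms by (auto simp: deficient_def)
  have v: "v \<in> F" "v \<in> V" using Fv FV by auto
  \<comment> \<open>Deficiency for the converse is measured against the in-degree of
    \<open>v\<close>, so this equality is what makes \<open>?D\<close> deficient.\<close>
  have deg: "card (in_nbhd E {v}) = card (out_nbhd E {v})"
    using card_in_nbhd_eq assms v by simp
  let ?D = "insert v (V - out_nbhd E F)"
  note D = dual_set[OF v(2) FV(1) Fv]
  have "card (boundary (E\<inverse>) ?D) \<le> card (boundary E F)"
    using D(2) finite_boundary[OF FV(2,1)] by (rule card_mono[rotated])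
  then have "deficient V (E\<inverse>) ?D"
    using D(1) assms(1) small deg v unfolding deficient_def out_nbhd_converse
    by (intro conjI exI[of _ v]) auto
  moreover have "card ?D + card F + card (boundary E F) \<le> card V + 1"
  proof -
    have "card ?D \<le> Suc (card (V - out_nbhd E F))" by (rule card_insert_le_m1) auto
    moreover have "card (V - out_nbhd E F) + card (out_nbhd E F) = card V"
      using assms out_nbhd_subset[of F]
      by (metis add.commute card_Diff_subset card_mono finite_subset le_add_diff_inverse)
    ultimately show ?thesis using card_out_nbhd[OF FV(2,1)] by simp
  qed
  \<comment> \<open>Otherwise every in-neighbour of \<open>v\<close> other than \<open>v\<close>
    would be in the boundary of \<open>F\<close>, which is too small for that.\<close>
  moreover have "out_nbhd E F \<noteq> V"
  proof
    assume "out_nbhd E F = V"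
    then have "in_nbhd E {v} - {v} \<subseteq> boundary E F"
      using Fv edges_subset by (auto simp: boundary_def in_nbhd_def)
    then have "card (in_nbhd E {v} - {v}) \<le> card (boundary E F)"
      using finite_boundary[OF FV(2,1)] by (rule card_mono[rotated])
    moreover have "v \<in> in_nbhd E {v}" using Fv by blast
    ultimately show False using small deg by simp
  qed
  ultimately show thesis by (rule that)
qed

text \<open>Minimality says nothing about \<open>Q\<close> when \<Gamma>(Q) = V, but then the
  boundary is all of \<open>V - Q\<close>, and the size bound suffices.\<close>

lemma boundary_ge_of_card:
  assumes "finite V"
    and min: "\<And>Y. Y \<subseteq> V \<Longrightarrow> Y \<noteq> {} \<Longrightarrow> out_nbhd E Y \<noteq> V \<Longrightarrow> k \<le> card (boundary E Y)"
    and Q: "Q \<subseteq> V" "Q \<noteq> {}" "card Q + k \<le> card V"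
  shows "k \<le> card (boundary E Q)"
proof (cases "out_nbhd E Q = V")
  case True
  then show ?thesis using Q assms card_out_nbhd[of Q] finite_subset[of Q V] by simp
next
  case False
  then show ?thesis using min Q by blast
qed

end

lemma obtain_minimal_deficient:
  assumes "deficient V E F"
  obtains G where "deficient V E G" "\<And>F'. deficient V E F' \<Longrightarrow> card G \<le> card F'"
    "card G \<le> card F"
  using assms ex_has_least_nat[of "deficient V E" F card] by blast

text \<open>For finite \<open>V\<close>, a set \<open>X\<close> of least boundary \<open>k\<close> among those with \<open>\<Gamma>(X) \<noteq> V\<close> satisfies the
  hypothesis of \<open>no_minimal_deficient\<close> as soon as \<open>|X| + |F| \<le> |V| - k + 1\<close>. The dual set
  \<open>N = V - \<Gamma>(X)\<close> plays the same role for the converse relation, and since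
  \<open>|X| + |N| = |V| - k\<close> while the two minimal deficient sets have total size at most
  \<open>|V| - k + 1\<close>, one of the two inequalities must hold.\<close>

lemma not_deficient_finite:
  assumes "transitive_relation V E" "finite V"
  shows "\<not> deficient V E F"
  using assms
proof (induction "card V" arbitrary: V E F rule: less_induct)
  case less
  interpret transitive_relation V E by (fact less.prems)
  interpret C: transitive_relation V "E\<inverse>" by (rule converse_transitive)
  note finV = \<open>finite V\<close>
  show ?case
  proof
    assume "deficient V E F"
    then obtain F where F: "deficient V E F"
      and Fmin: "\<And>F'. deficient V E F' \<Longrightarrow> card F \<le> card F'"
      using obtain_minimal_deficient by metis
    obtain D where D: "deficient V (E\<inverse>) D"
      "card D + card F + card (boundary E F) \<le> card V + 1" "out_nbhd E F \<noteq> V"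
      using finV F by (rule deficient_finite)
    obtain G where G: "deficient V (E\<inverse>) G"
      and Gmin: "\<And>F'. deficient V (E\<inverse>) F' \<Longrightarrow> card G \<le> card F'" and "card G \<le> card D"
      using obtain_minimal_deficient[OF D(1)] by metis
    have FV: "F \<subseteq> V" "F \<noteq> {}" using F by (auto simp: deficient_def)
    let ?P = "\<lambda>Y. Y \<subseteq> V \<and> Y \<noteq> {} \<and> out_nbhd E Y \<noteq> V"
    obtain X where X: "X \<subseteq> V" "X \<noteq> {}" "out_nbhd E X \<noteq> V"
      and Xmin: "\<And>Y. ?P Y \<Longrightarrow> card (boundary E X) \<le> card (boundary E Y)"
      using FV D(3) ex_has_least_nat[of ?P F "\<lambda>Y. card (boundary E Y)"] by blast
    define k where "k = card (boundary E X)"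
    have kF: "k \<le> card (boundary E F)" using Xmin FV D(3) by (simp add: k_def)
    have finX: "finite X" using X finV finite_subset by blast
    define N where "N = V - out_nbhd E X"
    have N: "N \<subseteq> V" "N \<noteq> {}" "finite N"
      using X out_nbhd_subset[of X] finV by (auto simp: N_def)
    have NV: "out_nbhd (E\<inverse>) N \<noteq> V"
      using in_nbhd_complement_subset[of X] X by (auto simp: N_def out_nbhd_converse)
    have cN: "card N + card X + k = card V"
      using card_out_nbhd[OF finX X(1)] finV out_nbhd_subset[of X] card_mono[OF finV out_nbhd_subset[of X]]
      by (simp add: N_def k_def card_Diff_subset finite_subset)
    have Cmin: "k \<le> card (boundary (E\<inverse>) Y)"
      if Y: "Y \<subseteq> V" "Y \<noteq> {}" "out_nbhd (E\<inverse>) Y \<noteq> V" for Y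
    proof -
      \<comment> \<open>Dualising back gives an admissible set for \<open>E\<close> with no larger
        boundary, so \<open>k\<close> bounds boundaries for the converse from below too.\<close>
      let ?Z = "V - out_nbhd (E\<inverse>) Y"
      have "?Z \<noteq> {}" using Y C.out_nbhd_subset by blast
      moreover have "out_nbhd E ?Z \<noteq> V"
        using C.in_nbhd_complement_subset[of Y] Y by (auto simp: in_nbhd_converse)
      ultimately have "k \<le> card (boundary E ?Z)" using Xmin[of ?Z] by (auto simp: k_def)
      also have "\<dots> \<le> card (boundary (E\<inverse>) Y)"
        using C.boundary_converse_complement[of Y] C.finite_boundary[of Y] Y finV
        by (intro card_mono) (auto intro: finite_subset)
      finally show ?thesis .
    qed
    have "card (boundary (E\<inverse>) N) \<le> k"
      unfolding k_def N_def using boundary_converse_complement finite_boundary[OF finX X(1)]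
      by (intro card_mono)
    then have kN: "card (boundary (E\<inverse>) N) = k"
      using Cmin[OF N(1,2) NV] by simp
    have IH: "\<not> deficient B R F'"
      if "transitive_relation B R" "finite B" "card B < card V" for B :: "'a set" and R F'
      using less.hyps that by blast
    have FX: "card V + 1 < card X + card F + k"
    proof (rule ccontr)
      assume le: "\<not> card V + 1 < card X + card F + k"
      show False
      proof (rule no_minimal_deficient[OF F Fmin X(1,2) finX])
        fix Q assume Q: "Q \<subseteq> V" "X \<subseteq> Q" "card Q < card X + card F"
        show "card (boundary E X) \<le> card (boundary E Q)"
          using boundary_ge_of_card[OF finV, of k Q] Xmin Q X le by (auto simp: k_def)
      next
        fix B :: "'a set" and R F' assume "transitive_relation B R" "card B \<le> card X" "finite B"
        \<comment> \<open>As \<open>N\<close> is nonempty, blocks of size at most |X| are smaller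
          than \<open>V\<close> and fall under the induction hypothesis.\<close>
        moreover have "card X < card V" using cN N card_gt_0_iff[of N] by linarith
        ultimately show "\<not> deficient B R F'" using IH by simp
      qed
    qed
    have GN: "card V + 1 < card N + card G + k"
    proof (rule ccontr)
      assume le: "\<not> card V + 1 < card N + card G + k"
      show False
      proof (rule C.no_minimal_deficient[OF G Gmin N])
        fix Q assume Q: "Q \<subseteq> V" "N \<subseteq> Q" "card Q < card N + card G"
        show "card (boundary (E\<inverse>) N) \<le> card (boundary (E\<inverse>) Q)"
          using C.boundary_ge_of_card[OF finV, of k Q] Cmin Q N le kN by auto
      next
        fix B :: "'a set" and R F' assume "transitive_relation B R" "card B \<le> card N" "finite B"
        moreover have "card N < card V" using cN X finX card_gt_0_iff[of X] by linarith
        ultimately show "\<not> deficient B R F'" using IH by simp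
      qed
    qed
    \<comment> \<open>Adding \<open>FX\<close> and \<open>GN\<close> and subtracting
      \<open>cN\<close> gives |F| + |G| + k \<ge> |V| + 4, whereas \<open>D(2)\<close> bounds this
      sum by |V| + 1.\<close>
    show False using FX GN cN D(2) kF \<open>card G \<le> card D\<close> by linarith
  qed
qed

section \<open>Arbitrary relations and the theorem\<close>

lemma (in transitive_relation) not_deficient: "\<not> deficient V E F"
proof (cases "finite V")
  case True
  then show ?thesis using not_deficient_finite transitive_relation_axioms by blast
next
  case False
  show ?thesis
  proof
    assume "deficient V E F"
    then obtain F where F: "deficient V E F"
      and Fmin: "\<And>F'. deficient V E F' \<Longrightarrow> card F \<le> card F'"
      using obtain_minimal_deficient by metis
    \<comment> \<open>Nonempty finite sets are closed under union, so least boundary alone controls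
      every finite \<open>Q\<close> containing \<open>X\<close>. Blocks are finite, so the finite
      case replaces induction.\<close>
    let ?P = "\<lambda>Y. Y \<subseteq> V \<and> Y \<noteq> {} \<and> finite Y"
    have "?P F" using F by (auto simp: deficient_def)
    then obtain X where X: "X \<subseteq> V" "X \<noteq> {}" "finite X"
      and Xmin: "\<And>Y. ?P Y \<Longrightarrow> card (boundary E X) \<le> card (boundary E Y)"
      using ex_has_least_nat[of ?P F "\<lambda>Y. card (boundary E Y)"] by blast
    show False
    proof (rule no_minimal_deficient[OF F Fmin X])
      fix Q assume "Q \<subseteq> V" "finite Q" "X \<subseteq> Q"
      then show "card (boundary E X) \<le> card (boundary E Q)" using Xmin X by blast
    next
      fix B :: "'a set" and R F' assume "transitive_relation B R" "finite B"
      then show "\<not> deficient B R F'" by (rule not_deficient_finite)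
    qed
  qed
qed

theorem theorem5p1:
  fixes V :: "'a set" and E :: "('a \<times> 'a) set" and v :: 'a and F :: "'a set"
  assumes "is_relation V E"
    and "point_transitive V E"
    and "rel_reflexive V E"
    and "locally_finite V E"
    and "v \<in> V"
    and "F \<subseteq> V"
    and "F \<inter> in_nbhd E {v} = {v}"
  shows "(finite F \<longrightarrow>
            card (out_nbhd E F - F) \<ge> card (out_nbhd E {v}) - 1)
       \<and> (finite (V - F) \<longrightarrow>
            card (out_nbhd E F - F) \<ge> card (in_nbhd E {v}) - 1)"
proof (intro conjI impI)
  interpret transitive_relation V E by unfold_locales (fact assms)+
  interpret C: transitive_relation V "E\<inverse>" by (rule converse_transitive)
  show "card (out_nbhd E F - F) \<ge> card (out_nbhd E {v}) - 1" if "finite F"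
    using not_deficient[of F] that assms(6,7)
    unfolding deficient_def boundary_def by (metis linorder_not_le)
  assume cofin: "finite (V - F)"
  \<comment> \<open>\<open>F\<close> lies in \<Gamma>(F), so cofiniteness of \<open>F\<close> makes
    this dual set finite, and the finite bound applies to it in the converse.\<close>
  let ?D = "insert v (V - out_nbhd E F)"
  note D = dual_set[OF assms(5-7)]
  have "finite ?D" "?D \<subseteq> V"
    using assms(5,6) subset_out_nbhd[of F] finite_subset[OF Diff_mono cofin] by auto
  then have "card (in_nbhd E {v}) - 1 \<le> card (boundary (E\<inverse>) ?D)"
    using C.not_deficient[of ?D] D(1)
    unfolding deficient_def out_nbhd_converse by (metis linorder_not_le)
  also have "\<dots> \<le> card (boundary E F)"
    using D(2) cofin out_nbhd_subset[of F]
    by (intro card_mono) (auto simp: boundary_def intro: finite_subset[OF Diff_mono cofin])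
  finally show "card (out_nbhd E F - F) \<ge> card (in_nbhd E {v}) - 1"
    by (simp add: boundary_def)
qed

end
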